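(* Let $d\ge1$ be an integer and $\alpha > -1$. Then there exists $C = C(\alpha,d) > 0$ such that for all integers $N \ge 0$ and all $p \in \Pi^d_N$, $$\| \nabla p \|_{[\mathrm{L}^2_{\rho^\alpha}(B^d)]^d} \le C\, N^2\, \| p \|_{\mathrm{L}^2_{\rho^\alpha}(B^d)}.$$
   Context: $B^d=\{x\in\mathbb{R}^d:|x|<1\}$ is the Euclidean unit ball, $\rho(x)=1-|x|^2$, and $\|u\|_{\mathrm{L}^2_{\rho^\alpha}(B^d)}^2=\int_{B^d}|u|^2\rho^\alpha$; for vector fields, $\|F\|_{[\mathrm{L}^2_{\rho^\alpha}(B^d)]^d}^2=\sum_{i=1}^d\|F_i\|_{\mathrm{L}^2_{\rho^\alpha}(B^d)}^2$. $\Pi^d_N$ is the space of complex polynomials in $d$ variables of total degree at most $N$. *)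

theory Defs
  imports "HOL-Analysis.Analysis"
begin

text \<open>
  The space \<open>\<real>\<^sup>d\<close> is rendered as the type \<open>real ^ 'd\<close> with \<open>d = CARD('d)\<close>; since types are nonempty,
  \<open>d \<ge> 1\<close> is automatic. The unit ball \<open>B\<^sup>d\<close> is \<open>ball 0 1\<close>.
\<close>

definition rho :: "real ^ 'd \<Rightarrow> real" where
  "rho x = 1 - (norm x)\<^sup>2"

text \<open>\<open>rho\<close> is positive on the open unit ball, so \<open>powr\<close> there is the usual real power.\<close>

definition weighted_L2_norm :: "real \<Rightarrow> (real ^ 'd \<Rightarrow> complex) \<Rightarrow> real" where
  "weighted_L2_norm \<alpha> u =
     sqrt (LINT x:ball 0 1|lborel. (cmod (u x))\<^sup>2 * rho x powr \<alpha>)"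

definition weighted_L2_norm_vec :: "real \<Rightarrow> (real ^ 'd \<Rightarrow> complex ^ 'd) \<Rightarrow> real" where
  "weighted_L2_norm_vec \<alpha> F =
     sqrt (\<Sum>i\<in>UNIV. (weighted_L2_norm \<alpha> (\<lambda>x. F x $ i))\<^sup>2)"

definition partial_deriv :: "'d \<Rightarrow> (real ^ 'd \<Rightarrow> complex) \<Rightarrow> real ^ 'd \<Rightarrow> complex" where
  "partial_deriv i u x = vector_derivative (\<lambda>t. u (x + t *\<^sub>R axis i 1)) (at 0)"

definition gradient :: "(real ^ 'd \<Rightarrow> complex) \<Rightarrow> real ^ 'd \<Rightarrow> complex ^ 'd" where
  "gradient u x = (\<chi> i. partial_deriv i u x)"

text \<open>
  Complex polynomials in \<open>d\<close> variables of total degree at most \<open>N\<close>, as functions on \<open>\<real>\<^sup>d\<close>. The sum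
  runs over the multi-indices \<open>a :: 'd \<Rightarrow> nat\<close> with \<open>\<bar>a\<bar> \<le> N\<close>, a finite set by the lemma below.
\<close>

definition poly_space :: "nat \<Rightarrow> (real ^ 'd \<Rightarrow> complex) set" where
  "poly_space N =
     {p. \<exists>c :: ('d \<Rightarrow> nat) \<Rightarrow> complex.
           p = (\<lambda>x. \<Sum>a | (\<Sum>i\<in>UNIV. a i) \<le> N. c a * (\<Prod>i\<in>UNIV. complex_of_real (x $ i) ^ a i))}"

lemma finite_multi_indices: "finite {a :: 'd::finite \<Rightarrow> nat. (\<Sum>i\<in>UNIV. a i) \<le> N}"
proof (rule finite_subset)
  show "{a :: 'd \<Rightarrow> nat. (\<Sum>i\<in>UNIV. a i) \<le> N} \<subseteq> (UNIV :: 'd set) \<rightarrow>\<^sub>E {..N}"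
  proof
    fix a :: "'d \<Rightarrow> nat"
    assume "a \<in> {a. (\<Sum>i\<in>UNIV. a i) \<le> N}"
    then have "a i \<le> N" for i
      using member_le_sum[of i UNIV a] by simp
    then show "a \<in> (UNIV :: 'd set) \<rightarrow>\<^sub>E {..N}"
      by (auto simp: PiE_def)
  qed
  show "finite ((UNIV :: 'd set) \<rightarrow>\<^sub>E {..N})"
    by (intro finite_PiE) auto
qed

end

theory Submission
  imports Defs
begin

text \<open>
  Markov's inequality is split into two inequalities whose one-dimensional versions on the chords
  \<open>t\<^sup>2 < R\<close>, \<open>R = 1 - \<bar>y\<bar>\<^sup>2\<close>, \<open>y \<bottom> e\<^sub>i\<close>, hold with constants that do not deteriorate for short chords.
  Bernstein: \<open>\<integral> \<bar>\<partial>\<^sub>i p\<bar>\<^sup>2 \<rho>\<^bsup>\<alpha>+1\<^esup> \<le> N (N + 2\<alpha> + 1) \<integral> \<bar>p\<bar>\<^sup>2 \<rho>\<^bsup>\<alpha>\<^esup>\<close>, because the Gegenbauer operator is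
  self-adjoint and triangular on polynomials. Inverse inequality: an integration by parts gives
  \<open>R \<integral> \<bar>q\<bar>\<^sup>2 \<rho>\<^bsup>\<alpha>\<^esup> \<le> K N\<^sup>2 \<integral> \<bar>q\<bar>\<^sup>2 \<rho>\<^bsup>\<alpha>+1\<^esup>\<close> on a chord. On the chord through \<open>x\<close> in direction \<open>i\<close> we have
  \<open>R = \<rho> x + x\<^sub>i\<^sup>2\<close>, and these numbers add up to at least one over all \<open>i\<close>, so summation over the
  directions removes the degenerate factor \<open>R\<close>. Apply the inverse inequality to \<open>q = \<partial>\<^sub>i p\<close>.
\<close>

subsection \<open>Integrals of polynomials against the Gegenbauer weight\<close>

definition chord_poly :: "real \<Rightarrow> real poly" where
  "chord_poly R = [:R, 0, -1:]"

text \<open>The gauge integral is convenient here: the fundamental theorem of calculus then yields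
  integrability as well as the value, even when the weight is unbounded. The endpoints are harmless
  since \<open>0 powr \<alpha> = 0\<close>.\<close>

definition gegen_int :: "real \<Rightarrow> real \<Rightarrow> real poly \<Rightarrow> real" where
  "gegen_int \<alpha> R f = integral {- sqrt R..sqrt R} (\<lambda>t. poly f t * (R - t\<^sup>2) powr \<alpha>)"

text \<open>With w = (R - t^2)^\<alpha> this is the divergence form - w^(-1) ((R - t^2) w q')',
  minus the Gegenbauer operator scaled to the chord.\<close>

definition gegen_op :: "real \<Rightarrow> real \<Rightarrow> real poly \<Rightarrow> real poly" where
  "gegen_op \<alpha> R q = smult (2 * (\<alpha> + 1)) ([:0, 1:] * pderiv q) - chord_poly R * pderiv (pderiv q)"

text \<open>These eigenvalues of \<open>gegen_op\<close> do not involve \<open>R\<close>; this is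
  why the chord inequalities are uniform in the length of the chord.\<close>

definition gegen_eig :: "real \<Rightarrow> nat \<Rightarrow> real" where
  "gegen_eig \<alpha> n = real n * (real n + 2 * \<alpha> + 1)"

lemma poly_chord_poly [simp]: "poly (chord_poly R) t = R - t\<^sup>2"
  by (simp add: chord_poly_def power2_eq_square)

lemma le_sqrt_iff_square_le:
  assumes "R > 0"
  shows "t \<in> {- sqrt R..sqrt R} \<longleftrightarrow> t\<^sup>2 \<le> R"
proof -
  have "t\<^sup>2 \<le> R \<longleftrightarrow> t\<^sup>2 \<le> (sqrt R)\<^sup>2" using assms by simp
  also have "\<dots> \<longleftrightarrow> \<bar>t\<bar> \<le> sqrt R" using assms
    by (metis abs_le_square_iff abs_of_nonneg real_sqrt_ge_0_iff less_imp_le)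
  finally show ?thesis by auto
qed

lemma less_sqrt_iff_square_less:
  assumes "R > 0"
  shows "t \<in> {- sqrt R<..<sqrt R} \<longleftrightarrow> t\<^sup>2 < R"
proof -
  have "t\<^sup>2 < R \<longleftrightarrow> \<not> R \<le> t\<^sup>2" by auto
  also have "\<dots> \<longleftrightarrow> \<not> sqrt R \<le> \<bar>t\<bar>"
    by (metis real_sqrt_abs real_sqrt_le_iff)
  finally show ?thesis by auto
qed

lemma powr_add_one:
  assumes "x \<ge> (0::real)"
  shows "x powr (\<alpha> + 1) = x * x powr \<alpha>"
  using assms by (cases "x = 0") (auto simp: powr_add)

text \<open>The integrand is the derivative of
  \<open>poly f t * (R - t\<^sup>2) powr (\<alpha> + 1)\<close>, which is continuous up to the
  endpoints and vanishes there because \<alpha> + 1 > 0.\<close>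

lemma has_integral_total_derivative:
  assumes "\<alpha> > -1" "R > 0"
  shows "((\<lambda>t. poly (chord_poly R * pderiv f - smult (2 * (\<alpha> + 1)) ([:0, 1:] * f)) t * (R - t\<^sup>2) powr \<alpha>)
           has_integral 0) {- sqrt R..sqrt R}"
proof -
  define F where "F t = poly f t * (R - t\<^sup>2) powr (\<alpha> + 1)" for t
  have "((\<lambda>t. poly (chord_poly R * pderiv f - smult (2 * (\<alpha> + 1)) ([:0, 1:] * f)) t * (R - t\<^sup>2) powr \<alpha>)
           has_integral (F (sqrt R) - F (- sqrt R))) {- sqrt R..sqrt R}"
  \<comment> \<open>Only the open interval is differentiated: for \<alpha> < 0 the derivative may
    blow up at the endpoints.\<close>
  proof (rule fundamental_theorem_of_calculus_interior)
    show "- sqrt R \<le> sqrt R" using assms by simp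
    show "continuous_on {- sqrt R..sqrt R} F"
      unfolding F_def
    proof (intro continuous_on_mult continuous_on_powr' continuous_intros)
      show "\<forall>x\<in>{- sqrt R..sqrt R}. 0 \<le> R - x\<^sup>2 \<and> (R - x\<^sup>2 = 0 \<longrightarrow> 0 < \<alpha> + 1)"
        using assms le_sqrt_iff_square_le[OF assms(2)] by auto
    qed
  next
    fix t assume "t \<in> {- sqrt R<..<sqrt R}"
    then have t: "R - t\<^sup>2 > 0" using less_sqrt_iff_square_less[OF assms(2)] by auto
    have "((\<lambda>t. R - t\<^sup>2) has_real_derivative - 2 * t) (at t)"
      by (auto intro!: derivative_eq_intros)
    from DERIV_mult[OF poly_DERIV[of f t] DERIV_fun_powr[OF this t, of "\<alpha> + 1"]]
    have "(F has_real_derivative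
        poly (pderiv f) t * (R - t\<^sup>2) powr (\<alpha> + 1)
        + (\<alpha> + 1) * (R - t\<^sup>2) powr \<alpha> * (- 2 * t) * poly f t) (at t)"
      by (simp add: F_def[abs_def])
    also have "poly (pderiv f) t * (R - t\<^sup>2) powr (\<alpha> + 1)
        + (\<alpha> + 1) * (R - t\<^sup>2) powr \<alpha> * (- 2 * t) * poly f t =
        poly (chord_poly R * pderiv f - smult (2 * (\<alpha> + 1)) ([:0, 1:] * f)) t * (R - t\<^sup>2) powr \<alpha>"
      unfolding powr_add_one[OF less_imp_le[OF t]] by (simp add: algebra_simps)
    finally show "(F has_vector_derivative
        poly (chord_poly R * pderiv f - smult (2 * (\<alpha> + 1)) ([:0, 1:] * f)) t * (R - t\<^sup>2) powr \<alpha>) (at t)"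
      by (simp add: has_real_derivative_iff_has_vector_derivative)
  qed
  moreover have "F (sqrt R) = 0" "F (- sqrt R) = 0"
    using assms by (simp_all add: F_def)
  ultimately show ?thesis by simp
qed

text \<open>For \<alpha> < 0 the weight w is unbounded. The total derivative with f = t shows that
  t^2 w is integrable, and R w = (R - t^2) w + t^2 w, where the first summand is continuous.\<close>

lemma integrable_gegen_weight:
  assumes "\<alpha> > -1" "R > 0"
  shows "(\<lambda>t. (R - t\<^sup>2) powr \<alpha>) absolutely_integrable_on {- sqrt R..sqrt R}"
proof (rule nonnegative_absolutely_integrable_1)
  let ?S = "{- sqrt R..sqrt R}"
  have S: "R - t\<^sup>2 \<ge> 0" if "t \<in> ?S" for t
    using that le_sqrt_iff_square_le[OF assms(2)] by auto
  have "(\<lambda>t. (R - t\<^sup>2) powr (\<alpha> + 1)) integrable_on ?S"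
    using assms S
    by (intro integrable_continuous_real continuous_on_powr' continuous_intros) auto
  moreover have "(\<lambda>t. (R - t\<^sup>2) powr (\<alpha> + 1) - 2 * (\<alpha> + 1) * (t\<^sup>2 * (R - t\<^sup>2) powr \<alpha>)) integrable_on ?S"
  proof (rule integrable_eq)
    show "(\<lambda>t. poly (chord_poly R * pderiv [:0, 1:] - smult (2 * (\<alpha> + 1)) ([:0, 1:] * [:0, 1:])) t
        * (R - t\<^sup>2) powr \<alpha>) integrable_on ?S"
      using has_integral_total_derivative[OF assms] by (rule has_integral_integrable)
  next
    fix t assume "t \<in> ?S"
    show "poly (chord_poly R * pderiv [:0, 1:] - smult (2 * (\<alpha> + 1)) ([:0, 1:] * [:0, 1:])) t
        * (R - t\<^sup>2) powr \<alpha> = (R - t\<^sup>2) powr (\<alpha> + 1) - 2 * (\<alpha> + 1) * (t\<^sup>2 * (R - t\<^sup>2) powr \<alpha>)"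
      unfolding powr_add_one[OF S[OF \<open>t \<in> ?S\<close>]]
      by (simp add: pderiv_pCons power2_eq_square algebra_simps)
  qed
  ultimately have "(\<lambda>t. (R - t\<^sup>2) powr (\<alpha> + 1) -
      ((R - t\<^sup>2) powr (\<alpha> + 1) - 2 * (\<alpha> + 1) * (t\<^sup>2 * (R - t\<^sup>2) powr \<alpha>))) integrable_on ?S"
    by (rule integrable_diff)
  from integrable_on_mult_right[OF this, of "1 / (2 * (\<alpha> + 1))"]
  have "(\<lambda>t. 1 / (2 * (\<alpha> + 1)) * (2 * (\<alpha> + 1) * (t\<^sup>2 * (R - t\<^sup>2) powr \<alpha>))) integrable_on ?S"
    by (simp only: diff_diff_eq2 add_diff_cancel_left')
  moreover have "1 / (2 * (\<alpha> + 1)) * (2 * (\<alpha> + 1) * y) = y" for y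
    using assms by (simp add: field_simps)
  ultimately have "(\<lambda>t. t\<^sup>2 * (R - t\<^sup>2) powr \<alpha>) integrable_on ?S"
    by (simp only:)
  with \<open>(\<lambda>t. (R - t\<^sup>2) powr (\<alpha> + 1)) integrable_on ?S\<close>
  have "(\<lambda>t. 1 / R * ((R - t\<^sup>2) powr (\<alpha> + 1) + t\<^sup>2 * (R - t\<^sup>2) powr \<alpha>)) integrable_on ?S"
    by (intro integrable_on_mult_right integrable_add)
  then show "(\<lambda>t. (R - t\<^sup>2) powr \<alpha>) integrable_on ?S"
  proof (rule integrable_eq)
    fix t assume "t \<in> ?S"
    show "1 / R * ((R - t\<^sup>2) powr (\<alpha> + 1) + t\<^sup>2 * (R - t\<^sup>2) powr \<alpha>) = (R - t\<^sup>2) powr \<alpha>"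
      unfolding powr_add_one[OF S[OF \<open>t \<in> ?S\<close>]] using assms by (simp add: field_simps)
  qed
qed auto

lemma integrable_poly_gegen:
  assumes "\<alpha> > -1" "R > 0"
  shows "(\<lambda>t. poly f t * (R - t\<^sup>2) powr \<alpha>) integrable_on {- sqrt R..sqrt R}"
proof -
  have "(\<lambda>t. poly f t * (R - t\<^sup>2) powr \<alpha>) absolutely_integrable_on {- sqrt R..sqrt R}"
  proof (rule absolutely_integrable_bounded_measurable_product_real)
    show "poly f \<in> borel_measurable (lebesgue_on {- sqrt R..sqrt R})"
      by (intro continuous_imp_measurable_on_sets_lebesgue) (auto intro: continuous_intros)
    show "bounded (poly f ` {- sqrt R..sqrt R})"
      by (intro compact_imp_bounded compact_continuous_image) (auto intro: continuous_intros)
  qed (use integrable_gegen_weight[OF assms] in auto)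
  then show ?thesis
    using set_lebesgue_integral_eq_integral(1) by blast
qed

text \<open>The difference factors as (n - k)(n + k + 2\<alpha> + 1). The second factor is positive
  since n + k is at least 1 and 2\<alpha> + 1 > -1.\<close>

lemma gegen_eig_strict_mono:
  assumes "\<alpha> > -1" "k < n"
  shows "gegen_eig \<alpha> k < gegen_eig \<alpha> n"
proof -
  have "gegen_eig \<alpha> n - gegen_eig \<alpha> k = (real n - real k) * (real n + real k + 2 * \<alpha> + 1)"
    by (simp add: gegen_eig_def algebra_simps)
  moreover have "real n + real k + 2 * \<alpha> + 1 > 0"
    using assms by (cases "k = 0") linarith+
  ultimately show ?thesis
    using assms by (smt (verit) mult_pos_pos of_nat_less_iff)
qed

lemma gegen_eig_nonneg: "\<alpha> > -1 \<Longrightarrow> gegen_eig \<alpha> n \<ge> 0"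
  using gegen_eig_strict_mono[of \<alpha> 0 n] by (cases n) (auto simp: gegen_eig_def)

context
  fixes \<alpha> R :: real
  assumes \<alpha>: "\<alpha> > -1" and R: "R > 0"
begin

lemma gegen_int_has_integral:
  "((\<lambda>t. poly f t * (R - t\<^sup>2) powr \<alpha>) has_integral gegen_int \<alpha> R f) {- sqrt R..sqrt R}"
  unfolding gegen_int_def by (intro integrable_integral integrable_poly_gegen \<alpha> R)

lemma gegen_int_0: "gegen_int \<alpha> R 0 = 0"
  by (simp add: gegen_int_def)

lemma gegen_int_add: "gegen_int \<alpha> R (f + g) = gegen_int \<alpha> R f + gegen_int \<alpha> R g"
  unfolding gegen_int_def by (simp add: distrib_right integral_add integrable_poly_gegen \<alpha> R)

lemma gegen_int_smult: "gegen_int \<alpha> R (smult c f) = c * gegen_int \<alpha> R f"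
  by (simp add: gegen_int_def mult.assoc)

lemma gegen_int_diff: "gegen_int \<alpha> R (f - g) = gegen_int \<alpha> R f - gegen_int \<alpha> R g"
  using gegen_int_add[of f "smult (-1) g"] gegen_int_smult[of "-1" g] by simp

lemma gegen_int_nonneg:
  assumes "\<And>t. t\<^sup>2 \<le> R \<Longrightarrow> poly f t \<ge> 0"
  shows "gegen_int \<alpha> R f \<ge> 0"
  using gegen_int_has_integral
proof (rule has_integral_nonneg)
  fix t assume "t \<in> {- sqrt R..sqrt R}"
  then show "0 \<le> poly f t * (R - t\<^sup>2) powr \<alpha>"
    using assms le_sqrt_iff_square_le[OF R] by simp
qed

lemma gegen_int_mono:
  assumes "\<And>t. t\<^sup>2 \<le> R \<Longrightarrow> poly f t \<le> poly g t"
  shows "gegen_int \<alpha> R f \<le> gegen_int \<alpha> R g"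
  using gegen_int_nonneg[of "g - f"] assms by (simp add: gegen_int_diff)

section \<open>The Gegenbauer operator: self-adjointness and eigenpolynomials\<close>

lemma gegen_int_by_parts:
  "gegen_int \<alpha> R (chord_poly R * pderiv f) = 2 * (\<alpha> + 1) * gegen_int \<alpha> R ([:0, 1:] * f)"
proof -
  have "gegen_int \<alpha> R (chord_poly R * pderiv f - smult (2 * (\<alpha> + 1)) ([:0, 1:] * f)) = 0"
    using has_integral_unique[OF gegen_int_has_integral has_integral_total_derivative[OF \<alpha> R]] .
  then show ?thesis by (simp only: gegen_int_diff gegen_int_smult)
qed

text \<open>The two integrands differ by a total derivative, that of \<open>pderiv u * v\<close>
  times the weight of exponent \<alpha> + 1. The right side is symmetric in \<open>u\<close> and
  \<open>v\<close>, and for \<open>u = v\<close> it is the energy in the Bernstein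
  inequality.\<close>

lemma gegen_int_gegen_op:
  "gegen_int \<alpha> R (gegen_op \<alpha> R u * v) = gegen_int \<alpha> R (chord_poly R * (pderiv u * pderiv v))"
proof -
  have "gegen_op \<alpha> R u * v = smult (2 * (\<alpha> + 1)) ([:0, 1:] * (pderiv u * v))
      - chord_poly R * pderiv (pderiv u * v) + chord_poly R * (pderiv u * pderiv v)"
    unfolding gegen_op_def pderiv_mult by (simp add: algebra_simps del: mult_pCons_left)
  then have "gegen_int \<alpha> R (gegen_op \<alpha> R u * v) = 2 * (\<alpha> + 1) * gegen_int \<alpha> R ([:0, 1:] * (pderiv u * v))
      - gegen_int \<alpha> R (chord_poly R * pderiv (pderiv u * v)) + gegen_int \<alpha> R (chord_poly R * (pderiv u * pderiv v))"
    by (simp only: gegen_int_add gegen_int_diff gegen_int_smult)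
  then show ?thesis by (simp only: gegen_int_by_parts)
qed

lemma gegen_int_op_sym: "gegen_int \<alpha> R (gegen_op \<alpha> R u * v) = gegen_int \<alpha> R (u * gegen_op \<alpha> R v)"
  using gegen_int_gegen_op[of u v] gegen_int_gegen_op[of v u] by (simp add: mult.commute)

text \<open>Triangularity in the monomial basis: the operator never raises the degree, and its
  diagonal entries are the numbers \<open>gegen_eig \<alpha> n\<close>.\<close>

lemma coeff_gegen_op:
  "coeff (gegen_op \<alpha> R q) n =
     gegen_eig \<alpha> n * coeff q n - R * (real n + 1) * (real n + 2) * coeff q (n + 2)"
proof -
  have jw: "chord_poly R * p = smult R p - pCons 0 (pCons 0 p)" for p
    by (simp add: chord_poly_def)
  show ?thesis
    unfolding gegen_op_def jw
    by (simp add: coeff_pderiv coeff_pCons gegen_eig_def algebra_simps split: nat.splits)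
qed

lemma gegen_op_add: "gegen_op \<alpha> R (u + v) = gegen_op \<alpha> R u + gegen_op \<alpha> R v"
  by (rule poly_eqI) (simp add: coeff_gegen_op algebra_simps)

lemma gegen_op_smult: "gegen_op \<alpha> R (smult c u) = smult c (gegen_op \<alpha> R u)"
  by (rule poly_eqI) (simp add: coeff_gegen_op algebra_simps)

text \<open>A triangular system with nonzero diagonal, solved from the top coefficient
  downwards.\<close>

lemma gegen_op_shift_surj:
  assumes "\<And>k. k < n \<Longrightarrow> gegen_eig \<alpha> k \<noteq> \<mu>" "\<And>k. k \<ge> n \<Longrightarrow> coeff v k = 0"
  shows "\<exists>u. (\<forall>k\<ge>n. coeff u k = 0) \<and> gegen_op \<alpha> R u - smult \<mu> u = v"
  using assms
proof (induction n arbitrary: v)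
  case 0
  then have "v = 0" by (intro poly_eqI) simp
  then show ?case by (intro exI[of _ 0]) (simp add: gegen_op_def)
next
  case (Suc n)
  \<comment> \<open>This monomial matches the coefficient of \<open>v\<close> at \<open>n\<close>;
    the remainder \<open>w\<close> has only lower coefficients and falls to the induction
    hypothesis.\<close>
  define u where "u = monom (coeff v n / (gegen_eig \<alpha> n - \<mu>)) n"
  define w where "w = v - (gegen_op \<alpha> R u - smult \<mu> u)"
  have ne: "gegen_eig \<alpha> n - \<mu> \<noteq> 0" using Suc.prems(1)[of n] by simp
  have "coeff w k = 0" if "k \<ge> n" for k
    using that Suc.prems(2)[of k] ne
    by (cases "k = n") (auto simp: w_def u_def coeff_gegen_op field_simps)
  then obtain u' where u': "\<forall>k\<ge>n. coeff u' k = 0" "gegen_op \<alpha> R u' - smult \<mu> u' = w"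
    using Suc.IH[of w] Suc.prems(1) by auto
  show ?case
    using u' by (intro exI[of _ "u + u'"])
      (auto simp: u_def[symmetric] w_def gegen_op_add smult_add_right, auto simp: u_def)
qed

text \<open>Take t^n plus a lower-order correction: applying the shifted operator to t^n cancels the
  leading term, so what is left lies in the range on lower degrees.\<close>

lemma gegen_op_eigenvector:
  "\<exists>e. coeff e n = 1 \<and> (\<forall>k>n. coeff e k = 0) \<and> gegen_op \<alpha> R e = smult (gegen_eig \<alpha> n) e"
proof -
  have "\<exists>u. (\<forall>k\<ge>n. coeff u k = 0) \<and> gegen_op \<alpha> R u - smult (gegen_eig \<alpha> n) u
      = - (gegen_op \<alpha> R (monom 1 n) - smult (gegen_eig \<alpha> n) (monom 1 n))"
  proof (rule gegen_op_shift_surj)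
    show "gegen_eig \<alpha> k \<noteq> gegen_eig \<alpha> n" if "k < n" for k
      using gegen_eig_strict_mono[OF \<alpha> that] by simp
  qed (auto simp: coeff_gegen_op)
  then obtain u where "\<forall>k\<ge>n. coeff u k = 0" and
    "gegen_op \<alpha> R u - smult (gegen_eig \<alpha> n) u = - (gegen_op \<alpha> R (monom 1 n) - smult (gegen_eig \<alpha> n) (monom 1 n))"
    by blast
  then show ?thesis
    by (intro exI[of _ "monom 1 n + u"]) (auto simp: gegen_op_add smult_add_right algebra_simps)
qed

text \<open>The range of \<open>gegen_op - gegen_eig \<alpha> n\<close> contains all lower degrees, so self-adjointness
  yields the orthogonality.\<close>

lemma gegen_op_eigenvector_orthogonal:
  assumes "gegen_op \<alpha> R e = smult (gegen_eig \<alpha> n) e" "\<And>k. k \<ge> n \<Longrightarrow> coeff v k = 0"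
  shows "gegen_int \<alpha> R (e * v) = 0"
proof -
  have "\<exists>u. (\<forall>k\<ge>n. coeff u k = 0) \<and> gegen_op \<alpha> R u - smult (gegen_eig \<alpha> n) u = v"
  proof (rule gegen_op_shift_surj)
    show "gegen_eig \<alpha> k \<noteq> gegen_eig \<alpha> n" if "k < n" for k
      using gegen_eig_strict_mono[OF \<alpha> that] by simp
  qed (use assms in auto)
  then obtain u where u: "v = gegen_op \<alpha> R u - smult (gegen_eig \<alpha> n) u" by blast
  have "gegen_int \<alpha> R (e * v) = gegen_int \<alpha> R (gegen_op \<alpha> R e * u) - gegen_eig \<alpha> n * gegen_int \<alpha> R (e * u)"
    by (simp add: u gegen_int_op_sym right_diff_distrib gegen_int_diff gegen_int_smult)
  then show ?thesis by (simp add: assms gegen_int_smult)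
qed

text \<open>Induction on the degree, splitting off the component along the eigenpolynomial of top
  degree. Orthogonality removes the cross terms from both the energy and the norm, and the
  eigenvalues increase with the degree.\<close>

lemma gegen_bernstein:
  assumes "degree q \<le> n"
  shows "gegen_int \<alpha> R (chord_poly R * (pderiv q)\<^sup>2) \<le> gegen_eig \<alpha> n * gegen_int \<alpha> R (q\<^sup>2)"
  using assms
proof (induction n arbitrary: q)
  case 0
  then have "pderiv q = 0" by (simp add: pderiv_eq_0_iff)
  then show ?case by (simp add: gegen_eig_def gegen_int_0)
next
  case (Suc n)
  let ?\<mu> = "gegen_eig \<alpha> (Suc n)" and ?c = "coeff q (Suc n)"
  obtain e where e: "coeff e (Suc n) = 1" "\<forall>k>Suc n. coeff e k = 0" "gegen_op \<alpha> R e = smult ?\<mu> e"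
    using gegen_op_eigenvector by blast
  define v where "v = q - smult ?c e"
  have v0: "coeff v k = 0" if "k \<ge> Suc n" for k
    using that e Suc.prems by (cases "k = Suc n") (auto simp: v_def coeff_eq_0)
  have q: "q = smult ?c e + v" by (simp add: v_def)
  have ev: "gegen_int \<alpha> R (e * v) = 0"
    using gegen_op_eigenvector_orthogonal e v0 by blast
  \<comment> \<open>Self-adjointness moves the operator onto \<open>e\<close>, where it acts as
    multiplication by the eigenvalue.\<close>
  have eLv: "gegen_int \<alpha> R (e * gegen_op \<alpha> R v) = 0"
    using ev by (simp add: e(3) gegen_int_op_sym[symmetric] gegen_int_smult)
  have "gegen_int \<alpha> R (chord_poly R * (pderiv q)\<^sup>2) = gegen_int \<alpha> R (gegen_op \<alpha> R q * q)"
    by (simp add: gegen_int_gegen_op power2_eq_square)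
  also have "gegen_op \<alpha> R q * q = smult (?c\<^sup>2 * ?\<mu>) (e * e) + smult (?c * ?\<mu>) (e * v)
      + smult ?c (e * gegen_op \<alpha> R v) + gegen_op \<alpha> R v * v"
    by (subst (1 2) q) (simp add: gegen_op_add gegen_op_smult e(3) algebra_simps power2_eq_square smult_add_right)
  also have "gegen_int \<alpha> R \<dots> = ?c\<^sup>2 * ?\<mu> * gegen_int \<alpha> R (e * e) + gegen_int \<alpha> R (chord_poly R * (pderiv v)\<^sup>2)"
    by (simp add: gegen_int_add gegen_int_smult ev eLv gegen_int_gegen_op power2_eq_square)
  also have "gegen_int \<alpha> R (chord_poly R * (pderiv v)\<^sup>2) \<le> gegen_eig \<alpha> n * gegen_int \<alpha> R (v\<^sup>2)"
    using v0 by (intro Suc.IH degree_le) auto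
  also have "\<dots> \<le> ?\<mu> * gegen_int \<alpha> R (v\<^sup>2)"
    using gegen_eig_strict_mono[OF \<alpha>, of n "Suc n"] by (intro mult_right_mono gegen_int_nonneg) auto
  also have "?c\<^sup>2 * ?\<mu> * gegen_int \<alpha> R (e * e) + ?\<mu> * gegen_int \<alpha> R (v\<^sup>2) = ?\<mu> * gegen_int \<alpha> R (q\<^sup>2)"
  proof -
    have "q\<^sup>2 = smult (?c\<^sup>2) (e * e) + smult ?c (e * v) + smult ?c (e * v) + v\<^sup>2"
      by (subst (1) q) (simp add: power2_eq_square algebra_simps)
    then have "gegen_int \<alpha> R (q\<^sup>2) = ?c\<^sup>2 * gegen_int \<alpha> R (e * e) + gegen_int \<alpha> R (v\<^sup>2)"
      by (simp only: gegen_int_add gegen_int_smult ev)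
    then show ?thesis by (simp add: algebra_simps)
  qed
  finally show ?case by simp
qed

text \<open>Since R = (R - t^2) + t^2, only the integral \<open>T\<close> of t^2 q^2 needs a bound.
  Integration by parts of t q^2 gives \<open>T\<close> a factor R - t^2 at the price of q', which
  Young's inequality and the Bernstein inequality control; the resulting multiple of R X is
  absorbed.\<close>

lemma gegen_inverse:
  assumes "degree q \<le> n"
  shows "R * gegen_int \<alpha> R (q\<^sup>2) \<le>
    (2 + (1 + (gegen_eig \<alpha> n + 1) / (\<alpha> + 1)) / (\<alpha> + 1)) * gegen_int \<alpha> R (chord_poly R * q\<^sup>2)"
proof -
  define X Y Z T where "X = gegen_int \<alpha> R (q\<^sup>2)" and "Y = gegen_int \<alpha> R (chord_poly R * q\<^sup>2)"
    and "Z = gegen_int \<alpha> R (chord_poly R * (pderiv q)\<^sup>2)" and "T = gegen_int \<alpha> R ([:0, 1:] * ([:0, 1:] * q\<^sup>2))"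
  \<comment> \<open>The Young parameter is chosen so that the q' term costs at most (\<alpha> + 1) R
    X, half of what stands on the left. The added 1 keeps \<open>M\<close> positive when
    \<open>n = 0\<close>.\<close>
  define M where "M = (gegen_eig \<alpha> n + 1) / (\<alpha> + 1)"
  have M: "M > 0" using gegen_eig_nonneg[OF \<alpha>, of n] \<alpha> by (simp add: M_def)
  have X: "X \<ge> 0" unfolding X_def by (intro gegen_int_nonneg) simp
  have Z: "Z \<le> gegen_eig \<alpha> n * X" unfolding Z_def X_def by (rule gegen_bernstein[OF assms])
  have RX: "R * X = Y + T"
  proof -
    have "smult R (q\<^sup>2) = chord_poly R * q\<^sup>2 + [:0, 1:] * ([:0, 1:] * q\<^sup>2)"
      by (simp add: chord_poly_def)
    then show ?thesis unfolding X_def Y_def T_def by (metis gegen_int_add gegen_int_smult)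
  qed
  have "2 * (\<alpha> + 1) * T = gegen_int \<alpha> R (chord_poly R * pderiv ([:0, 1:] * q\<^sup>2))"
    unfolding T_def by (rule gegen_int_by_parts[symmetric])
  also have "\<dots> \<le> gegen_int \<alpha> R (smult (1 + M) (chord_poly R * q\<^sup>2) + smult (R / M) (chord_poly R * (pderiv q)\<^sup>2))"
  proof (rule gegen_int_mono)
    fix t :: real assume t: "t\<^sup>2 \<le> R"
    let ?q = "poly q t" and ?q' = "poly (pderiv q) t"
    have "0 \<le> (M * ?q - t * ?q')\<^sup>2" by simp
    then have "M * (2 * t * ?q * ?q') \<le> M\<^sup>2 * ?q\<^sup>2 + t\<^sup>2 * ?q'\<^sup>2"
      by (simp add: power2_eq_square algebra_simps)
    also have "\<dots> \<le> M\<^sup>2 * ?q\<^sup>2 + R * ?q'\<^sup>2"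
      using t by (intro add_left_mono mult_right_mono) auto
    finally have "2 * t * ?q * ?q' \<le> M * ?q\<^sup>2 + R / M * ?q'\<^sup>2"
      using M by (simp add: field_simps power2_eq_square)
    then have "?q\<^sup>2 + 2 * t * ?q * ?q' \<le> (1 + M) * ?q\<^sup>2 + R / M * ?q'\<^sup>2"
      by (simp add: algebra_simps)
    then have "(R - t\<^sup>2) * (?q\<^sup>2 + 2 * t * ?q * ?q') \<le> (R - t\<^sup>2) * ((1 + M) * ?q\<^sup>2 + R / M * ?q'\<^sup>2)"
      using t by (intro mult_left_mono) auto
    moreover have "poly (chord_poly R * pderiv ([:0, 1:] * q\<^sup>2)) t = (R - t\<^sup>2) * (?q\<^sup>2 + 2 * t * ?q * ?q')"
      by (simp add: pderiv_mult pderiv_pCons power2_eq_square algebra_simps)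
    moreover have "poly (smult (1 + M) (chord_poly R * q\<^sup>2) + smult (R / M) (chord_poly R * (pderiv q)\<^sup>2)) t
        = (R - t\<^sup>2) * ((1 + M) * ?q\<^sup>2 + R / M * ?q'\<^sup>2)"
      by (simp add: distrib_left mult.left_commute)
    ultimately show "poly (chord_poly R * pderiv ([:0, 1:] * q\<^sup>2)) t \<le>
        poly (smult (1 + M) (chord_poly R * q\<^sup>2) + smult (R / M) (chord_poly R * (pderiv q)\<^sup>2)) t"
      by (simp only:)
  qed
  also have "\<dots> = (1 + M) * Y + R / M * Z"
    by (simp add: gegen_int_add gegen_int_smult Y_def Z_def)
  also have "R / M * Z \<le> R / M * ((gegen_eig \<alpha> n + 1) * X)"
    using Z X M R by (intro mult_left_mono) (auto simp: algebra_simps)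
  also have "\<dots> = (\<alpha> + 1) * (R * X)"
    using M \<alpha> gegen_eig_nonneg[OF \<alpha>, of n] by (simp add: M_def field_simps)
  finally have "2 * (\<alpha> + 1) * T \<le> (1 + M) * Y + (\<alpha> + 1) * (R * X)" by simp
  \<comment> \<open>Absorption: substitute T = R X - Y on the left.\<close>
  then have "(\<alpha> + 1) * (R * X) \<le> (2 * (\<alpha> + 1) + (1 + M)) * Y"
    using RX by (simp add: algebra_simps)
  then have "R * X \<le> (2 + (1 + M) / (\<alpha> + 1)) * Y"
    using \<alpha> by (simp add: field_simps)
  then show ?thesis unfolding X_def Y_def M_def .
qed

end

subsection \<open>Slicing integrals over the ball\<close>

lemma nn_integral_lborel_translate:
  fixes f :: "'a::euclidean_space \<Rightarrow> ennreal"
  assumes [measurable]: "f \<in> borel_measurable borel"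
  shows "(\<integral>\<^sup>+x. f (x + c) \<partial>lborel) = (\<integral>\<^sup>+x. f x \<partial>lborel)"
proof -
  have "(\<integral>\<^sup>+x. f x \<partial>lborel) = (\<integral>\<^sup>+x. f x \<partial>distr lborel borel ((+) c))"
    by (simp add: lborel_distr_plus)
  also have "\<dots> = (\<integral>\<^sup>+x. f (c + x) \<partial>lborel)"
    by (rule nn_integral_distr) auto
  finally show ?thesis by (simp add: add.commute)
qed

text \<open>Every line in direction \<open>i\<close> meets the slab \<open>0 \<le> x $ i < 1\<close> in a segment of length one.\<close>

lemma nn_integral_lines:
  fixes F :: "real ^ 'd \<Rightarrow> ennreal"
  assumes F [measurable]: "F \<in> borel_measurable borel"
  shows "(\<integral>\<^sup>+x. F x \<partial>lborel) =
    (\<integral>\<^sup>+x. indicator {x. 0 \<le> x $ i \<and> x $ i < 1} x * (\<integral>\<^sup>+t. F (x + t *\<^sub>R axis i 1) \<partial>lborel) \<partial>lborel)"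
proof -
  let ?e = "axis i 1 :: real ^ 'd" and ?S = "{x :: real ^ 'd. 0 \<le> x $ i \<and> x $ i < 1}"
  have S [measurable]: "?S \<in> sets borel" by measurable
  have "(\<integral>\<^sup>+x. indicator ?S x * (\<integral>\<^sup>+t. F (x + t *\<^sub>R ?e) \<partial>lborel) \<partial>lborel)
      = (\<integral>\<^sup>+x. (\<integral>\<^sup>+t. indicator ?S x * F (x + t *\<^sub>R ?e) \<partial>lborel) \<partial>lborel)"
    by (intro nn_integral_cong nn_integral_cmult[symmetric]) measurable
  also have "\<dots> = (\<integral>\<^sup>+t. (\<integral>\<^sup>+x. indicator ?S x * F (x + t *\<^sub>R ?e) \<partial>lborel) \<partial>lborel)"
    by (rule lborel_pair.Fubini'[symmetric]) measurable
  \<comment> \<open>For fixed \<open>t\<close>, translation invariance moves the shift from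
    \<open>F\<close> to the slab, so that \<open>F x\<close> comes out of the integral over
    \<open>t\<close>.\<close>
  also have "\<dots> = (\<integral>\<^sup>+t. (\<integral>\<^sup>+x. indicator ?S (x - t *\<^sub>R ?e) * F x \<partial>lborel) \<partial>lborel)"
  proof (rule nn_integral_cong)
    fix t :: real
    show "(\<integral>\<^sup>+x. indicator ?S x * F (x + t *\<^sub>R ?e) \<partial>lborel)
        = (\<integral>\<^sup>+x. indicator ?S (x - t *\<^sub>R ?e) * F x \<partial>lborel)"
      using nn_integral_lborel_translate[of "\<lambda>x. indicator ?S (x - t *\<^sub>R ?e) * F x" "t *\<^sub>R ?e"]
      by simp
  qed
  also have "\<dots> = (\<integral>\<^sup>+x. (\<integral>\<^sup>+t. indicator ?S (x - t *\<^sub>R ?e) * F x \<partial>lborel) \<partial>lborel)"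
    by (rule lborel_pair.Fubini') measurable
  also have "\<dots> = (\<integral>\<^sup>+x. F x \<partial>lborel)"
  proof (intro nn_integral_cong)
    fix x :: "real ^ 'd"
    have "(\<integral>\<^sup>+t. indicator ?S (x - t *\<^sub>R ?e) * F x \<partial>lborel)
        = (\<integral>\<^sup>+t. F x * indicator {x $ i - 1 <.. x $ i} t \<partial>lborel)"
      by (intro nn_integral_cong) (auto simp: indicator_def axis_def)
    also have "\<dots> = F x"
      by (subst nn_integral_cmult_indicator) auto
    finally show "(\<integral>\<^sup>+t. indicator ?S (x - t *\<^sub>R ?e) * F x \<partial>lborel) = F x" .
  qed
  finally show ?thesis ..
qed

text \<open>An extended nonnegative integral, so that slicing and comparison need no integrability.
  It is meant for \<open>h\<close> nonnegative on the ball, since \<open>ennreal\<close> cuts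
  negative values to 0.\<close>

definition ball_nn :: "real \<Rightarrow> (real ^ 'd \<Rightarrow> real) \<Rightarrow> ennreal" where
  "ball_nn \<alpha> h = (\<integral>\<^sup>+x. ennreal (indicator (ball 0 1) x * (h x * rho x powr \<alpha>)) \<partial>lborel)"

lemma rho_measurable [measurable]: "rho \<in> borel_measurable borel"
  unfolding rho_def[abs_def] by measurable

lemma norm_add_axis:
  fixes y :: "real ^ 'd"
  assumes "y $ i = 0"
  shows "(norm (y + t *\<^sub>R axis i 1))\<^sup>2 = (norm y)\<^sup>2 + t\<^sup>2"
  unfolding power2_norm_eq_inner
  using assms by (simp add: inner_add_left inner_add_right inner_axis inner_axis' power2_eq_square)

text \<open>By Pythagoras the line meets the ball in the chord t^2 < R, on which \<open>rho\<close>
  equals R - t^2.\<close>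

lemma nn_integral_line:
  fixes y :: "real ^ 'd"
  assumes \<alpha>: "\<alpha> > -1" and y: "y $ i = 0" "norm y < 1"
    and h: "\<And>x. norm x \<le> 1 \<Longrightarrow> h x \<ge> 0" "\<And>t. h (y + t *\<^sub>R axis i 1) = poly H t"
  shows "(\<integral>\<^sup>+t. ennreal (indicator (ball 0 1) (y + t *\<^sub>R axis i 1) *
      (h (y + t *\<^sub>R axis i 1) * rho (y + t *\<^sub>R axis i 1) powr \<alpha>)) \<partial>lborel)
    = ennreal (gegen_int \<alpha> (1 - (norm y)\<^sup>2) H)"
proof -
  define R where "R = 1 - (norm y)\<^sup>2"
  have R: "R > 0" using y(2) by (simp add: R_def power_less_one_iff)
  have norm_le: "norm (y + t *\<^sub>R axis i 1) \<le> 1 \<longleftrightarrow> t\<^sup>2 \<le> R" for t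
    using norm_add_axis[OF y(1), of t] abs_le_square_iff[of "norm (y + t *\<^sub>R axis i 1)" 1]
    by (auto simp: R_def)
  have norm_less: "norm (y + t *\<^sub>R axis i 1) < 1 \<longleftrightarrow> t\<^sup>2 < R" for t
    using norm_add_axis[OF y(1), of t] abs_square_less_1[of "norm (y + t *\<^sub>R axis i 1)"]
    by (auto simp: R_def)
  have "(\<integral>\<^sup>+t. ennreal (indicator (ball 0 1) (y + t *\<^sub>R axis i 1) *
      (h (y + t *\<^sub>R axis i 1) * rho (y + t *\<^sub>R axis i 1) powr \<alpha>)) \<partial>lborel)
    = (\<integral>\<^sup>+t. ennreal (indicator {- sqrt R..sqrt R} t * (poly H t * (R - t\<^sup>2) powr \<alpha>)) \<partial>lborel)"
  proof (intro nn_integral_cong)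
    fix t
    have "rho (y + t *\<^sub>R axis i 1) = R - t\<^sup>2"
      by (simp add: rho_def R_def norm_add_axis[OF y(1)])
    moreover have "indicator (ball 0 1) (y + t *\<^sub>R axis i 1) = (indicator {t. t\<^sup>2 < R} t :: real)"
      by (simp add: indicator_def norm_less)
    moreover have "indicator {- sqrt R..sqrt R} t = (indicator {t. t\<^sup>2 \<le> R} t :: real)"
      using le_sqrt_iff_square_le[OF R, of t] by (simp add: indicator_def)
    ultimately show "ennreal (indicator (ball 0 1) (y + t *\<^sub>R axis i 1) *
        (h (y + t *\<^sub>R axis i 1) * rho (y + t *\<^sub>R axis i 1) powr \<alpha>))
      = ennreal (indicator {- sqrt R..sqrt R} t * (poly H t * (R - t\<^sup>2) powr \<alpha>))"
      \<comment> \<open>At t^2 = R the open ball and the closed interval disagree, but there the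
        weight is \<open>0 powr \<alpha> = 0\<close>.\<close>
      by (cases "t\<^sup>2 = R") (auto simp: h(2) indicator_def)
  qed
  also have "\<dots> = ennreal (gegen_int \<alpha> R H)"
  proof (rule nn_integral_has_integral_lebesgue)
    show "((\<lambda>t. poly H t * (R - t\<^sup>2) powr \<alpha>) has_integral gegen_int \<alpha> R H) {- sqrt R..sqrt R}"
      by (rule gegen_int_has_integral[OF \<alpha> R])
    show "0 \<le> poly H t * (R - t\<^sup>2) powr \<alpha>" if "t \<in> {- sqrt R..sqrt R}" for t
      using that le_sqrt_iff_square_le[OF R, of t] norm_le h(1) by (simp flip: h(2))
  qed
  finally show ?thesis unfolding R_def .
qed

text \<open>The transfer principle: an inequality on every chord in direction \<open>i\<close>, with
  one constant for all chords, integrates to the ball.\<close>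

lemma ball_nn_mono_lines:
  fixes h k :: "real ^ 'd \<Rightarrow> real"
  assumes \<alpha>: "\<alpha> > -1" and c: "c \<ge> 0"
    and meas [measurable]: "h \<in> borel_measurable borel" "k \<in> borel_measurable borel"
    and nonneg: "\<And>x. norm x \<le> 1 \<Longrightarrow> h x \<ge> 0" "\<And>x. norm x \<le> 1 \<Longrightarrow> k x \<ge> 0"
    and lines: "\<And>y. y $ i = 0 \<Longrightarrow> norm y < 1 \<Longrightarrow> \<exists>H K. (\<forall>t. h (y + t *\<^sub>R axis i 1) = poly H t) \<and>
      (\<forall>t. k (y + t *\<^sub>R axis i 1) = poly K t) \<and>
      gegen_int \<alpha> (1 - (norm y)\<^sup>2) H \<le> c * gegen_int \<alpha> (1 - (norm y)\<^sup>2) K"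
  shows "ball_nn \<alpha> h \<le> ennreal c * ball_nn \<alpha> k"
proof -
  define F where "F h x = ennreal (indicator (ball 0 1) x * (h x * rho x powr \<alpha>))"
    for h and x :: "real ^ 'd"
  have F [measurable]: "F h \<in> borel_measurable borel" "F k \<in> borel_measurable borel"
  proof -
    have [measurable]: "ball 0 1 \<in> sets (borel :: (real ^ 'd) measure)" by simp
    show "F h \<in> borel_measurable borel" "F k \<in> borel_measurable borel"
      unfolding F_def[abs_def] by measurable
  qed
  have *: "(\<integral>\<^sup>+t. F h (y + t *\<^sub>R axis i 1) \<partial>lborel)
      \<le> ennreal c * (\<integral>\<^sup>+t. F k (y + t *\<^sub>R axis i 1) \<partial>lborel)" if y: "y $ i = 0" for y
  proof (cases "norm y < 1")
    case True
    from lines[OF y True] obtain H K where HK: "\<And>t. h (y + t *\<^sub>R axis i 1) = poly H t"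
      "\<And>t. k (y + t *\<^sub>R axis i 1) = poly K t"
      "gegen_int \<alpha> (1 - (norm y)\<^sup>2) H \<le> c * gegen_int \<alpha> (1 - (norm y)\<^sup>2) K"
      by blast
    have "(\<integral>\<^sup>+t. F h (y + t *\<^sub>R axis i 1) \<partial>lborel) = ennreal (gegen_int \<alpha> (1 - (norm y)\<^sup>2) H)"
      unfolding F_def by (rule nn_integral_line[OF \<alpha> y True]) (use nonneg HK in auto)
    moreover have "(\<integral>\<^sup>+t. F k (y + t *\<^sub>R axis i 1) \<partial>lborel) = ennreal (gegen_int \<alpha> (1 - (norm y)\<^sup>2) K)"
      unfolding F_def by (rule nn_integral_line[OF \<alpha> y True]) (use nonneg HK in auto)
    ultimately show ?thesis
      using HK(3) c by (simp add: ennreal_mult'[symmetric] ennreal_leI)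
  next
    case False
    \<comment> \<open>The base point is the point of the line closest to the origin, so the whole
      line misses the ball.\<close>
    have "\<not> norm (y + t *\<^sub>R axis i 1) < 1" for t
    proof -
      have "1 \<le> (norm y)\<^sup>2" using False by simp
      then have "1 \<le> (norm (y + t *\<^sub>R axis i 1))\<^sup>2"
        using norm_add_axis[OF y, of t] zero_le_power2[of t] by linarith
      then have "1\<^sup>2 \<le> (norm (y + t *\<^sub>R axis i 1))\<^sup>2" by (simp only: power_one)
      then have "1 \<le> norm (y + t *\<^sub>R axis i 1)" by (rule power2_le_imp_le) simp
      then show ?thesis by simp
    qed
    then have "F h (y + t *\<^sub>R axis i 1) = 0" for t
      by (simp add: F_def indicator_def)
    then show ?thesis by simp
  qed
  have line: "(\<integral>\<^sup>+t. F h (x + t *\<^sub>R axis i 1) \<partial>lborel)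
      \<le> ennreal c * (\<integral>\<^sup>+t. F k (x + t *\<^sub>R axis i 1) \<partial>lborel)" for x
  proof -
    \<comment> \<open>Slide the base point along the line into the hyperplane orthogonal to
      direction \<open>i\<close>; the line integral is unchanged.\<close>
    define y where "y = x - (x $ i) *\<^sub>R axis i 1"
    have "x + t *\<^sub>R axis i 1 = y + (t + x $ i) *\<^sub>R axis i 1" for t
      by (simp add: y_def algebra_simps)
    then have "(\<integral>\<^sup>+t. G (x + t *\<^sub>R axis i 1) \<partial>lborel) = (\<integral>\<^sup>+t. G (y + t *\<^sub>R axis i 1) \<partial>lborel)"
      if [measurable]: "G \<in> borel_measurable borel" for G :: "real ^ 'd \<Rightarrow> ennreal"
      using nn_integral_lborel_translate[of "\<lambda>t. G (y + t *\<^sub>R axis i 1)" "x $ i"] by simp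
    moreover have "y $ i = 0" by (simp add: y_def axis_def)
    ultimately show ?thesis using * F by simp
  qed
  let ?S = "{x :: real ^ 'd. 0 \<le> x $ i \<and> x $ i < 1}"
  have "ball_nn \<alpha> h = (\<integral>\<^sup>+x. indicator ?S x * (\<integral>\<^sup>+t. F h (x + t *\<^sub>R axis i 1) \<partial>lborel) \<partial>lborel)"
    unfolding ball_nn_def F_def[symmetric] by (rule nn_integral_lines) measurable
  also have "\<dots> \<le> (\<integral>\<^sup>+x. ennreal c * (indicator ?S x * (\<integral>\<^sup>+t. F k (x + t *\<^sub>R axis i 1) \<partial>lborel)) \<partial>lborel)"
    using line by (intro nn_integral_mono) (auto simp: indicator_def)
  also have "\<dots> = ennreal c * (\<integral>\<^sup>+x. indicator ?S x * (\<integral>\<^sup>+t. F k (x + t *\<^sub>R axis i 1) \<partial>lborel) \<partial>lborel)"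
    by (rule nn_integral_cmult) measurable
  also have "(\<integral>\<^sup>+x. indicator ?S x * (\<integral>\<^sup>+t. F k (x + t *\<^sub>R axis i 1) \<partial>lborel) \<partial>lborel) = ball_nn \<alpha> k"
    unfolding ball_nn_def F_def[symmetric] by (rule nn_integral_lines[symmetric]) measurable
  finally show ?thesis .
qed

subsection \<open>Weighted inequalities on the ball\<close>

text \<open>What the argument needs of a polynomial: degree control on lines parallel to the axes,
  plus continuity for measurability and for bounds on the closed ball.\<close>

definition linewise_poly :: "nat \<Rightarrow> (real ^ 'd \<Rightarrow> real) \<Rightarrow> bool" where
  "linewise_poly N f \<longleftrightarrow> continuous_on UNIV f \<and>
     (\<forall>i y. \<exists>P. degree P \<le> N \<and> (\<forall>t. f (y + t *\<^sub>R axis i 1) = poly P t))"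

lemma linewise_polyD:
  assumes "linewise_poly N f"
  obtains P where "degree P \<le> N" "\<And>t. f (y + t *\<^sub>R axis i 1) = poly P t"
  using assms unfolding linewise_poly_def by blast

lemma linewise_poly_measurable:
  "linewise_poly N f \<Longrightarrow> f \<in> borel_measurable borel"
  unfolding linewise_poly_def using borel_measurable_continuous_onI by blast

lemma linewise_poly_add:
  assumes "linewise_poly N f" "linewise_poly N g"
  shows "linewise_poly N (\<lambda>x. f x + g x)"
  unfolding linewise_poly_def
proof (intro conjI allI)
  show "continuous_on UNIV (\<lambda>x. f x + g x)"
    using assms unfolding linewise_poly_def by (intro continuous_on_add) auto
  fix i y
  obtain P where "degree P \<le> N" "\<And>t. f (y + t *\<^sub>R axis i 1) = poly P t"
    using linewise_polyD[OF assms(1)] by blast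
  moreover obtain Q where "degree Q \<le> N" "\<And>t. g (y + t *\<^sub>R axis i 1) = poly Q t"
    using linewise_polyD[OF assms(2)] by blast
  ultimately show "\<exists>P. degree P \<le> N \<and> (\<forall>t. f (y + t *\<^sub>R axis i 1) + g (y + t *\<^sub>R axis i 1) = poly P t)"
    by (intro exI[of _ "P + Q"]) (auto intro: degree_add_le)
qed

lemma linewise_poly_cmult:
  assumes "linewise_poly N f"
  shows "linewise_poly N (\<lambda>x. c * f x)"
  unfolding linewise_poly_def
proof (intro conjI allI)
  show "continuous_on UNIV (\<lambda>x. c * f x)"
    using assms unfolding linewise_poly_def by (intro continuous_on_mult_left) auto
  fix i y
  obtain P where "degree P \<le> N" "\<And>t. f (y + t *\<^sub>R axis i 1) = poly P t"
    using linewise_polyD[OF assms] by blast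
  then show "\<exists>P. degree P \<le> N \<and> (\<forall>t. c * f (y + t *\<^sub>R axis i 1) = poly P t)"
    by (intro exI[of _ "smult c P"]) (auto intro: order.trans[OF degree_smult_le])
qed

lemma linewise_poly_sum:
  assumes "finite S" "\<And>a. a \<in> S \<Longrightarrow> linewise_poly N (f a)"
  shows "linewise_poly N (\<lambda>x. \<Sum>a\<in>S. f a x)"
  using assms
proof (induction S rule: finite_induct)
  case empty
  show ?case unfolding linewise_poly_def by (auto intro: exI[of _ 0])
next
  case (insert a S)
  then show ?case by (simp add: linewise_poly_add)
qed

section \<open>Monomials and their derivatives along lines\<close>

definition monomial :: "('d \<Rightarrow> nat) \<Rightarrow> real ^ 'd \<Rightarrow> real" where
  "monomial a x = (\<Prod>j\<in>UNIV. (x $ j) ^ a j)"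

lemma monomial_split:
  "monomial a x = (x $ i) ^ a i * (\<Prod>j\<in>UNIV - {i}. (x $ j) ^ a j)"
  unfolding monomial_def by (rule prod.remove) auto

lemma monomial_line:
  "monomial a (y + t *\<^sub>R axis i 1) = (y $ i + t) ^ a i * (\<Prod>j\<in>UNIV - {i}. (y $ j) ^ a j)"
proof -
  have "(\<Prod>j\<in>UNIV - {i}. ((y + t *\<^sub>R axis i 1) $ j) ^ a j) = (\<Prod>j\<in>UNIV - {i}. (y $ j) ^ a j)"
    by (rule prod.cong) (auto simp: axis_def)
  then show ?thesis by (subst monomial_split[of _ _ i]) (simp add: axis_def)
qed

lemma linewise_poly_monomial:
  assumes "(\<Sum>j\<in>UNIV. a j) \<le> N"
  shows "linewise_poly N (monomial a)"
  unfolding linewise_poly_def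
proof (intro conjI allI)
  show "continuous_on UNIV (monomial a)"
    unfolding monomial_def[abs_def] by (intro continuous_intros)
  fix i :: 'a and y :: "real ^ 'a"
  have "a i \<le> N" using member_le_sum[of i UNIV a] assms by simp
  moreover have "degree ([:y $ i, 1:] ^ a i) \<le> a i"
    using degree_power_le[of "[:y $ i, 1:]" "a i"] by simp
  ultimately show "\<exists>P. degree P \<le> N \<and> (\<forall>t. monomial a (y + t *\<^sub>R axis i 1) = poly P t)"
    by (intro exI[of _ "smult (\<Prod>j\<in>UNIV - {i}. (y $ j) ^ a j) ([:y $ i, 1:] ^ a i)"])
      (auto simp: monomial_line mult.commute intro: order.trans[OF degree_smult_le])
qed

text \<open>The truncated subtraction \<open>a i - 1\<close> does no harm: if
  \<open>a i = 0\<close>, the factor \<open>real (a i)\<close> vanishes.\<close>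

lemma monomial_has_derivative:
  "((\<lambda>t. monomial a (x + t *\<^sub>R axis i 1)) has_real_derivative
      real (a i) * monomial (a(i := a i - 1)) (x + s *\<^sub>R axis i 1)) (at s)"
proof -
  have "(\<Prod>j\<in>UNIV - {i}. (x $ j) ^ (a(i := a i - 1)) j) = (\<Prod>j\<in>UNIV - {i}. (x $ j) ^ a j)"
    by (rule prod.cong) auto
  then have "monomial (a(i := a i - 1)) (x + s *\<^sub>R axis i 1) =
      (x $ i + s) ^ (a i - 1) * (\<Prod>j\<in>UNIV - {i}. (x $ j) ^ a j)"
    by (simp add: monomial_line)
  then show ?thesis
    unfolding monomial_line by (auto intro!: derivative_eq_intros)
qed

section \<open>From chords to the ball\<close>

definition inverse_const :: "real \<Rightarrow> nat \<Rightarrow> real" where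
  "inverse_const \<alpha> N = 2 + (1 + (gegen_eig \<alpha> N + 1) / (\<alpha> + 1)) / (\<alpha> + 1)"

lemma inverse_const_nonneg:
  assumes "\<alpha> > -1"
  shows "inverse_const \<alpha> N \<ge> 0"
  unfolding inverse_const_def using gegen_eig_nonneg[OF assms, of N] assms by simp

lemma rho_nonneg: "norm x \<le> 1 \<Longrightarrow> rho x \<ge> 0"
  by (simp add: rho_def abs_square_le_1)

lemma rho_add_axis:
  assumes "y $ i = 0"
  shows "rho (y + t *\<^sub>R axis i 1) = poly (chord_poly (1 - (norm y)\<^sup>2)) t"
  by (simp add: rho_def norm_add_axis[OF assms])

text \<open>\<open>gegen_bernstein\<close> on each chord; the extra factor \<open>rho\<close> raises
  the exponent of the weight to \<alpha> + 1.\<close>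

lemma ball_nn_bernstein:
  assumes \<alpha>: "\<alpha> > -1" and f: "linewise_poly N f" and g: "linewise_poly N g"
    and deriv: "\<And>x s. ((\<lambda>t. f (x + t *\<^sub>R axis i 1)) has_real_derivative g (x + s *\<^sub>R axis i 1)) (at s)"
  shows "ball_nn \<alpha> (\<lambda>x. rho x * (g x)\<^sup>2) \<le> ennreal (gegen_eig \<alpha> N) * ball_nn \<alpha> (\<lambda>x. (f x)\<^sup>2)"
proof (rule ball_nn_mono_lines[OF \<alpha>, where i = i])
  note [measurable] = linewise_poly_measurable[OF f] linewise_poly_measurable[OF g]
  show "(\<lambda>x. rho x * (g x)\<^sup>2) \<in> borel_measurable borel" "(\<lambda>x. (f x)\<^sup>2) \<in> borel_measurable borel"
    by measurable
  show "gegen_eig \<alpha> N \<ge> 0" using gegen_eig_nonneg[OF \<alpha>] .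
  fix y :: "real ^ 'a" assume y: "y $ i = 0" "norm y < 1"
  obtain P where P: "degree P \<le> N" "\<And>t. f (y + t *\<^sub>R axis i 1) = poly P t"
    using linewise_polyD[OF f] by blast
  \<comment> \<open>Uniqueness of derivatives identifies \<open>g\<close> on the line with the
    formal derivative of \<open>P\<close>.\<close>
  have g': "g (y + t *\<^sub>R axis i 1) = poly (pderiv P) t" for t
    using deriv[of y t] unfolding P(2) by (rule DERIV_unique) (rule poly_DERIV)
  have "1 - (norm y)\<^sup>2 > 0" using y(2) by (simp add: power_less_one_iff)
  from gegen_bernstein[OF \<alpha> this P(1)]
  show "\<exists>H K. (\<forall>t. rho (y + t *\<^sub>R axis i 1) * (g (y + t *\<^sub>R axis i 1))\<^sup>2 = poly H t) \<and>
      (\<forall>t. (f (y + t *\<^sub>R axis i 1))\<^sup>2 = poly K t) \<and>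
      gegen_int \<alpha> (1 - (norm y)\<^sup>2) H \<le> gegen_eig \<alpha> N * gegen_int \<alpha> (1 - (norm y)\<^sup>2) K"
    by (intro exI[of _ "chord_poly (1 - (norm y)\<^sup>2) * (pderiv P)\<^sup>2"] exI[of _ "P\<^sup>2"])
      (simp add: rho_add_axis[OF y(1)] g' P(2) del: poly_chord_poly)
qed (auto intro!: mult_nonneg_nonneg rho_nonneg)

text \<open>Along a line in direction \<open>i\<close> the factor
  \<open>rho x + (x $ i)\<^sup>2\<close> is the constant R of \<open>gegen_inverse\<close>.\<close>

lemma ball_nn_inverse_line:
  assumes \<alpha>: "\<alpha> > -1" and f: "linewise_poly N f"
  shows "ball_nn \<alpha> (\<lambda>x. (rho x + (x $ i)\<^sup>2) * (f x)\<^sup>2) \<le>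
    ennreal (inverse_const \<alpha> N) * ball_nn \<alpha> (\<lambda>x. rho x * (f x)\<^sup>2)"
proof (rule ball_nn_mono_lines[OF \<alpha>, where i = i])
  note [measurable] = linewise_poly_measurable[OF f]
  show "(\<lambda>x. (rho x + (x $ i)\<^sup>2) * (f x)\<^sup>2) \<in> borel_measurable borel"
    "(\<lambda>x. rho x * (f x)\<^sup>2) \<in> borel_measurable borel"
    by measurable
  show "inverse_const \<alpha> N \<ge> 0" using inverse_const_nonneg[OF \<alpha>] .
  fix y :: "real ^ 'a" assume y: "y $ i = 0" "norm y < 1"
  obtain P where P: "degree P \<le> N" "\<And>t. f (y + t *\<^sub>R axis i 1) = poly P t"
    using linewise_polyD[OF f] by blast
  have R: "1 - (norm y)\<^sup>2 > 0" using y(2) by (simp add: power_less_one_iff)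
  have "rho (y + t *\<^sub>R axis i 1) + ((y + t *\<^sub>R axis i 1) $ i)\<^sup>2 = 1 - (norm y)\<^sup>2" for t
    unfolding rho_add_axis[OF y(1)] using y(1) by (simp add: axis_def)
  with gegen_inverse[OF \<alpha> R P(1), folded inverse_const_def]
  show "\<exists>H K. (\<forall>t. (rho (y + t *\<^sub>R axis i 1) + ((y + t *\<^sub>R axis i 1) $ i)\<^sup>2)
        * (f (y + t *\<^sub>R axis i 1))\<^sup>2 = poly H t) \<and>
      (\<forall>t. rho (y + t *\<^sub>R axis i 1) * (f (y + t *\<^sub>R axis i 1))\<^sup>2 = poly K t) \<and>
      gegen_int \<alpha> (1 - (norm y)\<^sup>2) H \<le> inverse_const \<alpha> N * gegen_int \<alpha> (1 - (norm y)\<^sup>2) K"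
    by (intro exI[of _ "smult (1 - (norm y)\<^sup>2) (P\<^sup>2)"] exI[of _ "chord_poly (1 - (norm y)\<^sup>2) * P\<^sup>2"])
      (simp add: rho_add_axis[OF y(1)] gegen_int_smult[OF \<alpha> R] P(2) del: poly_chord_poly)
qed (auto intro!: mult_nonneg_nonneg add_nonneg_nonneg rho_nonneg)

text \<open>The sum equals d \<open>rho x\<close> + |x|^2, and d is at least 1.\<close>

lemma sum_rho_add_square_ge_one:
  fixes x :: "real ^ 'd"
  assumes "norm x \<le> 1"
  shows "(\<Sum>i\<in>UNIV. rho x + (x $ i)\<^sup>2) \<ge> 1"
proof -
  have "(\<Sum>i\<in>UNIV. (x $ i)\<^sup>2) = (norm x)\<^sup>2"
    by (simp add: norm_vec_def L2_set_def sum_nonneg)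
  moreover have "1 * rho x \<le> real CARD('d) * rho x"
    using rho_nonneg[OF assms] by (intro mult_right_mono) auto
  ultimately show ?thesis by (simp add: sum.distrib rho_def)
qed

lemma borel_measurable_ball_integrand:
  fixes h :: "real ^ 'd \<Rightarrow> real"
  assumes [measurable]: "h \<in> borel_measurable borel"
  shows "(\<lambda>x. indicator (ball 0 1) x * (h x * rho x powr \<alpha>)) \<in> borel_measurable borel"
proof -
  have [measurable]: "ball 0 1 \<in> sets (borel :: (real ^ 'd) measure)" by simp
  show ?thesis by measurable
qed

text \<open>Insert the sum of the direction factors, which is at least 1, and bound each of the d
  terms in its own direction; this produces the factor \<open>CARD('d)\<close>.\<close>

lemma ball_nn_inverse:
  fixes f :: "real ^ 'd \<Rightarrow> real"
  assumes \<alpha>: "\<alpha> > -1" and f: "linewise_poly N f"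
  shows "ball_nn \<alpha> (\<lambda>x. (f x)\<^sup>2) \<le>
    ennreal (real CARD('d) * inverse_const \<alpha> N) * ball_nn \<alpha> (\<lambda>x. rho x * (f x)\<^sup>2)"
proof -
  note [measurable] = linewise_poly_measurable[OF f]
  let ?w = "\<lambda>i x. indicator (ball 0 1) x * ((rho x + (x $ i)\<^sup>2) * (f x)\<^sup>2 * rho x powr \<alpha>)"
  have nonneg: "?w i x \<ge> 0" for i x
    by (cases "norm x < 1") (auto intro!: mult_nonneg_nonneg add_nonneg_nonneg rho_nonneg simp: indicator_def)
  have "ball_nn \<alpha> (\<lambda>x. (f x)\<^sup>2) \<le> (\<integral>\<^sup>+x. (\<Sum>i\<in>UNIV. ennreal (?w i x)) \<partial>lborel)"
    unfolding ball_nn_def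
  proof (rule nn_integral_mono)
    fix x :: "real ^ 'd"
    have "indicator (ball 0 1) x * ((f x)\<^sup>2 * rho x powr \<alpha>) \<le> (\<Sum>i\<in>UNIV. ?w i x)"
    proof (cases "norm x < 1")
      case True
      have "1 * ((f x)\<^sup>2 * rho x powr \<alpha>) \<le> (\<Sum>i\<in>UNIV. rho x + (x $ i)\<^sup>2) * ((f x)\<^sup>2 * rho x powr \<alpha>)"
        using True by (intro mult_right_mono sum_rho_add_square_ge_one) auto
      then show ?thesis using True by (simp add: sum_distrib_right mult.assoc)
    qed simp
    then show "ennreal (indicator (ball 0 1) x * ((f x)\<^sup>2 * rho x powr \<alpha>)) \<le> (\<Sum>i\<in>UNIV. ennreal (?w i x))"
      using nonneg by (simp add: ennreal_leI)
  qed
  also have "\<dots> = (\<Sum>i\<in>UNIV. ball_nn \<alpha> (\<lambda>x. (rho x + (x $ i)\<^sup>2) * (f x)\<^sup>2))"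
    unfolding ball_nn_def
  proof (rule nn_integral_sum)
    fix i :: 'd
    have [measurable]: "?w i \<in> borel_measurable borel"
      by (rule borel_measurable_ball_integrand) measurable
    show "(\<lambda>x. ennreal (?w i x)) \<in> borel_measurable lborel" by measurable
  qed
  also have "\<dots> \<le> (\<Sum>i\<in>(UNIV :: 'd set). ennreal (inverse_const \<alpha> N) * ball_nn \<alpha> (\<lambda>x. rho x * (f x)\<^sup>2))"
    by (intro sum_mono ball_nn_inverse_line[OF \<alpha> f])
  also have "\<dots> = ennreal (real CARD('d) * inverse_const \<alpha> N) * ball_nn \<alpha> (\<lambda>x. rho x * (f x)\<^sup>2)"
    by (simp add: ennreal_mult' ennreal_of_nat_eq_real_of_nat mult.assoc)
  finally show ?thesis .
qed

text \<open>For \<open>\<alpha> < 0\<close> the weight is unbounded; the inverse inequality trades it for \<open>\<alpha> + 1 > 0\<close>.\<close>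

lemma ball_nn_finite:
  fixes f :: "real ^ 'd \<Rightarrow> real"
  assumes \<alpha>: "\<alpha> > -1" and f: "linewise_poly N f"
  shows "ball_nn \<alpha> (\<lambda>x. (f x)\<^sup>2) < \<infinity>"
proof -
  have "bounded (f ` cball 0 1)"
    using f unfolding linewise_poly_def
    by (intro compact_imp_bounded compact_continuous_image) (auto intro: continuous_on_subset)
  then obtain B where "\<forall>y\<in>f ` cball 0 1. norm y \<le> B"
    unfolding bounded_iff by blast
  then have B: "\<bar>f x\<bar> \<le> B" if "norm x \<le> 1" for x
    using that by simp
  have "ball_nn \<alpha> (\<lambda>x. rho x * (f x)\<^sup>2) \<le> (\<integral>\<^sup>+x. ennreal (B\<^sup>2) * indicator (ball 0 1) (x :: real ^ 'd) \<partial>lborel)"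
    unfolding ball_nn_def
  proof (rule nn_integral_mono)
    fix x :: "real ^ 'd"
    have "rho x * (f x)\<^sup>2 * rho x powr \<alpha> \<le> B\<^sup>2" if x: "norm x < 1"
    proof -
      have r: "rho x \<ge> 0" "rho x \<le> 1" using rho_nonneg[of x] x by (auto simp: rho_def)
      \<comment> \<open>The extra \<open>rho\<close> makes the exponent positive, so the weight is
        at most 1 on the ball.\<close>
      have "rho x * (f x)\<^sup>2 * rho x powr \<alpha> = (f x)\<^sup>2 * rho x powr (\<alpha> + 1)"
        by (simp add: powr_add_one[OF r(1)])
      also have "\<dots> \<le> B\<^sup>2 * 1"
      proof (intro mult_mono)
        show "(f x)\<^sup>2 \<le> B\<^sup>2" using B[of x] x by (simp add: abs_le_square_iff[symmetric])
        show "rho x powr (\<alpha> + 1) \<le> 1" using r \<alpha> by (intro powr_le1) auto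
      qed auto
      finally show ?thesis by simp
    qed
    then show "ennreal (indicator (ball 0 1) x * (rho x * (f x)\<^sup>2 * rho x powr \<alpha>))
        \<le> ennreal (B\<^sup>2) * indicator (ball 0 1) x"
      by (auto simp: indicator_def intro: ennreal_leI)
  qed
  also have "\<dots> = ennreal (B\<^sup>2) * emeasure lborel (ball 0 1 :: (real ^ 'd) set)"
    by (rule nn_integral_cmult_indicator) simp
  also have "\<dots> < \<infinity>"
    using emeasure_lborel_ball_finite[of "0 :: real ^ 'd" 1] by (simp add: ennreal_mult_less_top)
  finally have "ennreal (real CARD('d) * inverse_const \<alpha> N) * ball_nn \<alpha> (\<lambda>x. rho x * (f x)\<^sup>2) < \<infinity>"
    by (simp add: ennreal_mult_less_top)
  with ball_nn_inverse[OF \<alpha> f] show ?thesis by (rule le_less_trans)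
qed

text \<open>The inverse inequality for \<open>g\<close> adds a factor \<open>rho\<close>, which the
  Bernstein inequality then removes in passing from \<open>g\<close> to \<open>f\<close>.\<close>

lemma ball_nn_markov:
  fixes f :: "real ^ 'd \<Rightarrow> real"
  assumes \<alpha>: "\<alpha> > -1" and f: "linewise_poly N f" and g: "linewise_poly N g"
    and deriv: "\<And>x s. ((\<lambda>t. f (x + t *\<^sub>R axis i 1)) has_real_derivative g (x + s *\<^sub>R axis i 1)) (at s)"
  shows "ball_nn \<alpha> (\<lambda>x. (g x)\<^sup>2) \<le>
    ennreal (real CARD('d) * inverse_const \<alpha> N * gegen_eig \<alpha> N) * ball_nn \<alpha> (\<lambda>x. (f x)\<^sup>2)"
proof -
  have "ball_nn \<alpha> (\<lambda>x. (g x)\<^sup>2) \<le>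
      ennreal (real CARD('d) * inverse_const \<alpha> N) * ball_nn \<alpha> (\<lambda>x. rho x * (g x)\<^sup>2)"
    by (rule ball_nn_inverse[OF \<alpha> g])
  also have "\<dots> \<le> ennreal (real CARD('d) * inverse_const \<alpha> N) *
      (ennreal (gegen_eig \<alpha> N) * ball_nn \<alpha> (\<lambda>x. (f x)\<^sup>2))"
    by (intro mult_left_mono ball_nn_bernstein[OF \<alpha> f g deriv]) simp
  also have "\<dots> = ennreal (real CARD('d) * inverse_const \<alpha> N * gegen_eig \<alpha> N) * ball_nn \<alpha> (\<lambda>x. (f x)\<^sup>2)"
    using inverse_const_nonneg[OF \<alpha>, of N] by (simp add: ennreal_mult' mult.assoc)
  finally show ?thesis .
qed

text \<open>Both factors grow at most like N^2. At \<open>N = 0\<close> the eigenvalue vanishes; for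
  \<open>N \<ge> 1\<close> every constant term is at most that constant times N^2.\<close>

lemma markov_const_le:
  assumes \<alpha>: "\<alpha> > -1"
  shows "\<exists>K>0. \<forall>N. inverse_const \<alpha> N * gegen_eig \<alpha> N \<le> K * (real N) ^ 4"
proof -
  \<comment> \<open>\<open>l\<close> is chosen so that N + 2\<alpha> + 1 is at most N l once
    \<open>N \<ge> 1\<close>; \<open>b\<close> is \<open>inverse_const\<close> with \<open>l\<close>
    in place of the eigenvalue.\<close>
  define l where "l = 1 + \<bar>2 * \<alpha> + 1\<bar>"
  define b where "b = 2 + (1 + (l + 1) / (\<alpha> + 1)) / (\<alpha> + 1)"
  have l: "l > 0" by (simp add: l_def)
  have b: "b > 0" unfolding b_def using l \<alpha> by (intro add_pos_nonneg) auto
  have "inverse_const \<alpha> N * gegen_eig \<alpha> N \<le> (b * l) * (real N) ^ 4" for N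
  proof (cases "N = 0")
    case True
    then show ?thesis by (simp add: gegen_eig_def)
  next
    case False
    then have N: "real N \<ge> 1" by simp
    then have N2: "(real N)\<^sup>2 \<ge> 1" by simp
    have "2 * \<alpha> + 1 \<le> real N * \<bar>2 * \<alpha> + 1\<bar>"
      using mult_right_mono[OF N, of "\<bar>2 * \<alpha> + 1\<bar>"] by simp
    then have "real N * (real N + 2 * \<alpha> + 1) \<le> real N * (real N * l)"
      by (intro mult_left_mono) (auto simp: l_def algebra_simps)
    then have gegen_eig: "gegen_eig \<alpha> N \<le> l * (real N)\<^sup>2"
      by (simp add: gegen_eig_def power2_eq_square mult_ac)
    have "inverse_const \<alpha> N \<le> 2 * (real N)\<^sup>2 + (1 * (real N)\<^sup>2 + (l * (real N)\<^sup>2 + 1 * (real N)\<^sup>2) / (\<alpha> + 1)) / (\<alpha> + 1)"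
      unfolding inverse_const_def using \<alpha> N2 gegen_eig
      by (intro add_mono divide_right_mono) auto
    also have "\<dots> = b * (real N)\<^sup>2"
      by (simp add: b_def add_divide_distrib distrib_right)
    finally have "inverse_const \<alpha> N * gegen_eig \<alpha> N \<le> (b * (real N)\<^sup>2) * (l * (real N)\<^sup>2)"
      using gegen_eig gegen_eig_nonneg[OF \<alpha>, of N] b by (intro mult_mono) auto
    then show ?thesis by (simp add: mult_ac power_add[symmetric] flip: power2_eq_square)
  qed
  moreover have "b * l > 0" using b l by simp
  ultimately show ?thesis by blast
qed

subsection \<open>Complex polynomials\<close>

lemma ball_nn_add:
  fixes u v :: "real ^ 'd \<Rightarrow> real"
  assumes "u \<in> borel_measurable borel" "v \<in> borel_measurable borel"
    and "\<And>x. u x \<ge> 0" "\<And>x. v x \<ge> 0"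
  shows "ball_nn \<alpha> (\<lambda>x. u x + v x) = ball_nn \<alpha> u + ball_nn \<alpha> v"
proof -
  note [measurable] = borel_measurable_ball_integrand[OF assms(1)] borel_measurable_ball_integrand[OF assms(2)]
  have "ball_nn \<alpha> (\<lambda>x. u x + v x) =
      (\<integral>\<^sup>+x. ennreal (indicator (ball 0 1) x * (u x * rho x powr \<alpha>)) +
        ennreal (indicator (ball 0 1) x * (v x * rho x powr \<alpha>)) \<partial>lborel)"
    unfolding ball_nn_def using assms(3,4)
    by (intro nn_integral_cong) (simp add: ennreal_plus[symmetric] algebra_simps del: ennreal_plus)
  also have "\<dots> = ball_nn \<alpha> u + ball_nn \<alpha> v"
    unfolding ball_nn_def by (rule nn_integral_add) measurable
  finally show ?thesis .
qed

text \<open>No finiteness is required: if the integral diverges, both the Lebesgue integral and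
  \<open>enn2real\<close> return 0.\<close>

lemma weighted_L2_norm_Complex:
  fixes u v :: "real ^ 'd \<Rightarrow> real"
  assumes [measurable]: "u \<in> borel_measurable borel" "v \<in> borel_measurable borel"
  shows "weighted_L2_norm \<alpha> (\<lambda>x. Complex (u x) (v x)) =
    sqrt (enn2real (ball_nn \<alpha> (\<lambda>x. (u x)\<^sup>2) + ball_nn \<alpha> (\<lambda>x. (v x)\<^sup>2)))"
proof -
  have uv: "(\<lambda>x. (u x)\<^sup>2 + (v x)\<^sup>2) \<in> borel_measurable borel" by measurable
  have "(LINT x:ball 0 1|lborel. (cmod (Complex (u x) (v x)))\<^sup>2 * rho x powr \<alpha>)
      = (\<integral>x. indicator (ball 0 1) x * (((u x)\<^sup>2 + (v x)\<^sup>2) * rho x powr \<alpha>) \<partial>lborel)"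
    by (simp add: set_lebesgue_integral_def cmod_power2)
  also have "\<dots> = enn2real (ball_nn \<alpha> (\<lambda>x. (u x)\<^sup>2 + (v x)\<^sup>2))"
    unfolding ball_nn_def
    using borel_measurable_ball_integrand[OF uv] by (intro integral_eq_nn_integral) auto
  also have "ball_nn \<alpha> (\<lambda>x. (u x)\<^sup>2 + (v x)\<^sup>2) = ball_nn \<alpha> (\<lambda>x. (u x)\<^sup>2) + ball_nn \<alpha> (\<lambda>x. (v x)\<^sup>2)"
    by (rule ball_nn_add) simp_all
  finally show ?thesis by (simp add: weighted_L2_norm_def)
qed

definition poly_comb :: "nat \<Rightarrow> (('d::finite \<Rightarrow> nat) \<Rightarrow> real) \<Rightarrow> real ^ 'd \<Rightarrow> real" where
  "poly_comb N b x = (\<Sum>a | (\<Sum>j\<in>UNIV. a j) \<le> N. b a * monomial a x)"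

definition poly_comb_deriv :: "nat \<Rightarrow> (('d::finite \<Rightarrow> nat) \<Rightarrow> real) \<Rightarrow> 'd \<Rightarrow> real ^ 'd \<Rightarrow> real" where
  "poly_comb_deriv N b i x =
     (\<Sum>a | (\<Sum>j\<in>UNIV. a j) \<le> N. b a * (real (a i) * monomial (a(i := a i - 1)) x))"

lemma linewise_poly_comb: "linewise_poly N (poly_comb N b)"
  unfolding poly_comb_def[abs_def]
  by (intro linewise_poly_sum linewise_poly_cmult linewise_poly_monomial finite_multi_indices) auto

lemma linewise_poly_comb_deriv: "linewise_poly N (poly_comb_deriv N b i)"
  unfolding poly_comb_deriv_def[abs_def]
proof (intro linewise_poly_sum linewise_poly_cmult linewise_poly_monomial finite_multi_indices)
  fix a :: "'a \<Rightarrow> nat" assume "a \<in> {a. (\<Sum>j\<in>UNIV. a j) \<le> N}"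
  moreover have "(\<Sum>j\<in>UNIV. (a(i := a i - 1)) j) \<le> (\<Sum>j\<in>UNIV. a j)"
    by (rule sum_mono) simp
  ultimately show "(\<Sum>j\<in>UNIV. (a(i := a i - 1)) j) \<le> N" by simp
qed

lemma poly_comb_has_derivative:
  "((\<lambda>t. poly_comb N b (x + t *\<^sub>R axis i 1)) has_real_derivative
     poly_comb_deriv N b i (x + s *\<^sub>R axis i 1)) (at s)"
  unfolding poly_comb_def poly_comb_deriv_def
  by (intro DERIV_sum DERIV_cmult monomial_has_derivative)

text \<open>Monomials are real at real points, so splitting the coefficients into real and imaginary
  parts splits the polynomial.\<close>

lemma poly_space_Complex:
  assumes "p \<in> poly_space N"
  obtains b c where "p = (\<lambda>x. Complex (poly_comb N b x) (poly_comb N c x))"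
proof -
  from assms obtain c where c: "p = (\<lambda>x. \<Sum>a | (\<Sum>i\<in>UNIV. a i) \<le> N. c a * (\<Prod>i\<in>UNIV. complex_of_real (x $ i) ^ a i))"
    unfolding poly_space_def by blast
  have monomial: "(\<Prod>i\<in>UNIV. complex_of_real (x $ i) ^ a i) = complex_of_real (monomial a x)" for a x
    by (simp add: monomial_def)
  have "p = (\<lambda>x. Complex (poly_comb N (Re \<circ> c) x) (poly_comb N (Im \<circ> c) x))"
    unfolding c monomial by (auto simp: poly_comb_def complex_eq_iff)
  then show thesis by (rule that)
qed

lemma partial_deriv_Complex:
  "partial_deriv i (\<lambda>x. Complex (poly_comb N b x) (poly_comb N c x)) x =
     Complex (poly_comb_deriv N b i x) (poly_comb_deriv N c i x)"
  unfolding partial_deriv_def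
proof (rule vector_derivative_at)
  show "((\<lambda>t. Complex (poly_comb N b (x + t *\<^sub>R axis i 1)) (poly_comb N c (x + t *\<^sub>R axis i 1)))
      has_vector_derivative Complex (poly_comb_deriv N b i x) (poly_comb_deriv N c i x)) (at 0)"
    using poly_comb_has_derivative[of N b x i 0] poly_comb_has_derivative[of N c x i 0]
    by (simp add: has_vector_derivative_complex_iff has_real_derivative_iff_has_vector_derivative)
qed

theorem lemma2p11:
  fixes \<alpha> :: real
  assumes "\<alpha> > -1"
  shows "\<exists>C > 0. \<forall>N :: nat. \<forall>p \<in> (poly_space N :: (real ^ 'd \<Rightarrow> complex) set).
           weighted_L2_norm_vec \<alpha> (gradient p) \<le> C * (real N)\<^sup>2 * weighted_L2_norm \<alpha> p"
proof -
  let ?d = "real CARD('d)"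
  obtain K where K: "K > 0" "\<And>N. inverse_const \<alpha> N * gegen_eig \<alpha> N \<le> K * real N ^ 4"
    using markov_const_le[OF assms] by blast
  show ?thesis
  \<comment> \<open>One factor d comes from the inverse inequality and one from summing d partial
    derivatives; the square root of d^2 K N^4 is d sqrt(K) N^2.\<close>
  proof (intro exI[of _ "?d * sqrt K"] conjI allI ballI)
    show "?d * sqrt K > 0" using K(1) by simp
    fix N and p :: "real ^ 'd \<Rightarrow> complex" assume "p \<in> poly_space N"
    then obtain b c where p: "p = (\<lambda>x. Complex (poly_comb N b x) (poly_comb N c x))"
      by (rule poly_space_Complex)
    define B where "B = ball_nn \<alpha> (\<lambda>x. (poly_comb N b x)\<^sup>2) + ball_nn \<alpha> (\<lambda>x. (poly_comb N c x)\<^sup>2)"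
    define A where "A i = ball_nn \<alpha> (\<lambda>x. (poly_comb_deriv N b i x)\<^sup>2)
      + ball_nn \<alpha> (\<lambda>x. (poly_comb_deriv N c i x)\<^sup>2)" for i
    define M where "M = ?d * inverse_const \<alpha> N * gegen_eig \<alpha> N"
    have M: "M \<ge> 0"
      unfolding M_def using inverse_const_nonneg[OF assms] gegen_eig_nonneg[OF assms] by simp
    have pB: "weighted_L2_norm \<alpha> p = sqrt (enn2real B)"
      unfolding p B_def
      by (intro weighted_L2_norm_Complex linewise_poly_measurable[OF linewise_poly_comb])
    have gA: "weighted_L2_norm \<alpha> (\<lambda>x. gradient p x $ i) = sqrt (enn2real (A i))" for i
      unfolding gradient_def p A_def partial_deriv_Complex vec_lambda_beta
      by (intro weighted_L2_norm_Complex linewise_poly_measurable[OF linewise_poly_comb_deriv])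
    \<comment> \<open>Finiteness matters here: \<open>enn2real\<close> sends infinity to 0, so the
      bound in \<open>ennreal\<close> passes to the reals only if its right side is finite.\<close>
    have fin: "B < \<infinity>"
      unfolding B_def
    using ball_nn_finite[OF assms linewise_poly_comb[of N b]]
      ball_nn_finite[OF assms linewise_poly_comb[of N c]] by simp
    have AB: "enn2real (A i) \<le> M * enn2real B" for i
    proof -
      have "ball_nn \<alpha> (\<lambda>x. (poly_comb_deriv N b i x)\<^sup>2) \<le> ennreal M * ball_nn \<alpha> (\<lambda>x. (poly_comb N b x)\<^sup>2)"
        for b
        unfolding M_def
        by (rule ball_nn_markov[OF assms linewise_poly_comb linewise_poly_comb_deriv poly_comb_has_derivative])
      then have "A i \<le> ennreal M * B"
        unfolding A_def B_def distrib_left by (intro add_mono)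
      moreover have "ennreal M * B < \<infinity>" using fin by (simp add: ennreal_mult_less_top)
      ultimately have "enn2real (A i) \<le> enn2real (ennreal M * B)"
        by (intro enn2real_mono) auto
      then show ?thesis using M by (simp add: enn2real_mult)
    qed
    have "(\<Sum>i\<in>UNIV. enn2real (A i)) \<le> (\<Sum>i\<in>(UNIV :: 'd set). M * enn2real B)"
      by (intro sum_mono AB)
    also have "\<dots> = ?d\<^sup>2 * (inverse_const \<alpha> N * gegen_eig \<alpha> N) * enn2real B"
      by (simp add: M_def power2_eq_square mult_ac)
    also have "\<dots> \<le> ?d\<^sup>2 * (K * real N ^ 4) * enn2real B"
      by (intro mult_right_mono mult_left_mono K(2)) auto
    finally have "sqrt (\<Sum>i\<in>UNIV. enn2real (A i)) \<le> sqrt (?d\<^sup>2 * (K * real N ^ 4) * enn2real B)"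
      by (rule real_sqrt_le_mono)
    also have "\<dots> = ?d * sqrt K * (real N)\<^sup>2 * sqrt (enn2real B)"
    proof -
      have "sqrt (real N ^ 4) = (real N)\<^sup>2"
        by (rule real_sqrt_unique) (simp_all add: power_mult[symmetric])
      then show ?thesis by (simp add: real_sqrt_mult mult_ac)
    qed
    finally show "weighted_L2_norm_vec \<alpha> (gradient p) \<le> ?d * sqrt K * (real N)\<^sup>2 * weighted_L2_norm \<alpha> p"
      by (simp add: weighted_L2_norm_vec_def gA pB)
  qed
qed

end
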